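(* For every $\varepsilon>0$, every deterministic online algorithm for online decomposable weighted bipartite matching with free disposal (defined in the context) has competitive ratio at most $\frac{\sqrt5-1}{2}+\varepsilon$; that is, there is an instance on which its value is at most $\left(\frac{\sqrt5-1}{2}+\varepsilon\right)\mathrm{OPT}$.
   Context: Problem (online decomposable weighted bipartite matching with free disposal). A finite set $V_1$ of machines with speeds $s:V_1\to\mathbb{R}_{>0}$ is known in advance. Jobs $v$ with sizes $w(v)>0$ arrive one at a time; when $v$ arrives, $w(v)$ is revealed and the algorithm must immediately and irrevocably assign $v$ to a machine (any job may go to any machine; a machine may receive several jobs). At the end, each machine $u$ earns $s(u)$ times the maximum size of a job assigned to it (0 if none); the algorithm's value is the sum of these earnings. $\mathrm{OPT}$ is the maximum value over all offline assignments. The competitive ratio of an algorithm is the infimum over instances of (its value)/$\mathrm{OPT}$. *)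

theory Defs
  imports Complex_Main "HOL-Library.FuncSet"
begin

text \<open>
  Machines are named by natural numbers. A job sequence is the list of the job sizes in order of
  arrival; the job at position \<open>i\<close> has size \<open>ws ! i\<close>. An assignment maps
  positions to machines.
\<close>

definition machine_env :: "nat set \<Rightarrow> (nat \<Rightarrow> real) \<Rightarrow> bool" where
  "machine_env V s \<longleftrightarrow> finite V \<and> V \<noteq> {} \<and> (\<forall>u\<in>V. s u > 0)"

text \<open>
  The empty job sequence is excluded: there value and optimum are both 0, so the ratio is not
  defined (and would be 0 under the convention \<open>0 / 0 = 0\<close>).
\<close>

definition job_sequence :: "real list \<Rightarrow> bool" where
  "job_sequence ws \<longleftrightarrow> ws \<noteq> [] \<and> (\<forall>w\<in>set ws. w > 0)"

definition max_job :: "real list \<Rightarrow> (nat \<Rightarrow> nat) \<Rightarrow> nat \<Rightarrow> real" where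
  "max_job ws f u =
     (let J = {i. i < length ws \<and> f i = u} in if J = {} then 0 else Max ((\<lambda>i. ws ! i) ` J))"

definition assignment_value ::
    "nat set \<Rightarrow> (nat \<Rightarrow> real) \<Rightarrow> real list \<Rightarrow> (nat \<Rightarrow> nat) \<Rightarrow> real" where
  "assignment_value V s ws f = (\<Sum>u\<in>V. s u * max_job ws f u)"

definition OPT :: "nat set \<Rightarrow> (nat \<Rightarrow> real) \<Rightarrow> real list \<Rightarrow> real" where
  "OPT V s ws = Max (assignment_value V s ws ` ({..<length ws} \<rightarrow>\<^sub>E V))"

text \<open>
  A deterministic online algorithm sees the machines, their speeds and the sizes of the jobs that
  have arrived so far, the last one being the current job, and names the machine for the current
  job. Its own earlier decisions are determined by the prefixes of that list and need not be
  passed. Values of \<open>s\<close> outside \<open>V\<close> carry no meaning; an algorithm is not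
  forbidden to look at them, which only enlarges the class of algorithms.
\<close>

type_synonym algorithm = "nat set \<Rightarrow> (nat \<Rightarrow> real) \<Rightarrow> real list \<Rightarrow> nat"

definition online_algorithm :: "algorithm \<Rightarrow> bool" where
  "online_algorithm A \<longleftrightarrow>
     (\<forall>V s ws. machine_env V s \<longrightarrow> job_sequence ws \<longrightarrow> A V s ws \<in> V)"

definition algorithm_value ::
    "algorithm \<Rightarrow> nat set \<Rightarrow> (nat \<Rightarrow> real) \<Rightarrow> real list \<Rightarrow> real" where
  "algorithm_value A V s ws = assignment_value V s ws (\<lambda>i. A V s (take (Suc i) ws))"

definition competitive_ratio :: "algorithm \<Rightarrow> real" where
  "competitive_ratio A =
     Inf {algorithm_value A V s ws / OPT V s ws | V s ws. machine_env V s \<and> job_sequence ws}"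

end

theory Submission
  imports Defs
begin

text \<open>
  Take one machine of speed 1 and many of a small speed \<open>s\<close>, and fix \<open>\<rho>\<close> slightly above
  \<open>(sqrt 5 - 1) / 2\<close>. The sizes \<open>w 0 = 1, w 1, \<dots>\<close> increase and are chosen by
  \<open>w n + s * w (n+1) = \<rho> * (w (n+1) + s * (w 0 + \<dots> + w n))\<close>: an algorithm that has put every
  job so far on the fast machine and now puts job \<open>n + 1\<close> on a slow one has ratio exactly
  \<open>\<rho>\<close>, since all jobs but the last can earn \<open>s\<close> offline. An algorithm that always uses the
  fast machine earns only \<open>w n\<close>, while the optimum is \<open>w n + s * (w 0 + \<dots> + w (n-1))\<close>. If
  this ratio stayed above \<open>\<rho>\<close>, the quotients \<open>r = w (n+1) / w n\<close> would stay positive. But they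
  obey \<open>a * r' = b - 1 / r\<close> with \<open>a = \<rho> - s\<close> and \<open>b = (1 + \<rho>) * (1 - s)\<close>, which has no
  fixed point when \<open>b\<^sup>2 < 4 * a\<close>, so they decrease by at least a constant in each step. The choice
  \<open>s = 1 - 2 / (1 + \<rho>)\<^sup>2\<close> gives \<open>b\<^sup>2 < 4 * a\<close> precisely when
  \<open>(1 - \<rho>) * (1 + \<rho>)\<^sup>2 < 1\<close>, that is, when \<open>\<rho>\<close> exceeds \<open>(sqrt 5 - 1) / 2\<close>.
\<close>

section \<open>Values of assignments\<close>

lemma max_job_cong:
  assumes "\<And>i. i < length ws \<Longrightarrow> f i = g i"
  shows "max_job ws f u = max_job ws g u"
proof -
  have "{i. i < length ws \<and> f i = u} = {i. i < length ws \<and> g i = u}"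
    using assms by auto
  then show ?thesis by (simp add: max_job_def)
qed

lemma assignment_value_cong:
  assumes "\<And>i. i < length ws \<Longrightarrow> f i = g i"
  shows "assignment_value V s ws f = assignment_value V s ws g"
  unfolding assignment_value_def using max_job_cong[of ws f g] assms by simp

lemma max_job_ge: "i < length ws \<Longrightarrow> ws ! i \<le> max_job ws f (f i)"
  by (auto simp: max_job_def Let_def intro!: Max_ge)

lemma max_job_nonneg:
  assumes "\<forall>w\<in>set ws. w > 0"
  shows "max_job ws f u \<ge> 0"
proof (cases "\<exists>i<length ws. f i = u")
  case True
  then obtain i where i: "i < length ws" "f i = u" by blast
  then have "0 < ws ! i" using assms by simp
  then show ?thesis using max_job_ge[OF i(1), of f] i(2) by simp
next
  case False
  then have "{i. i < length ws \<and> f i = u} = {}" by auto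
  then show ?thesis by (simp add: max_job_def)
qed

lemma max_job_le:
  assumes "\<And>i. i < length ws \<Longrightarrow> f i = u \<Longrightarrow> ws ! i \<le> b" and "b \<ge> 0"
  shows "max_job ws f u \<le> b"
  using assms by (auto simp: max_job_def Let_def)

lemma assignment_value_nonneg:
  assumes "machine_env V s" and "job_sequence ws"
  shows "assignment_value V s ws f \<ge> 0"
  unfolding assignment_value_def
  using assms by (intro sum_nonneg mult_nonneg_nonneg max_job_nonneg)
    (auto simp: machine_env_def job_sequence_def less_imp_le)

lemma assignment_value_le_OPT:
  assumes "machine_env V s" and "f \<in> {..<length ws} \<rightarrow> V"
  shows "assignment_value V s ws f \<le> OPT V s ws"
proof -
  \<comment> \<open>\<open>OPT\<close> ranges over extensional functions only, so \<open>f\<close>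
    is first cut down to the job positions.\<close>
  have "assignment_value V s ws f = assignment_value V s ws (restrict f {..<length ws})"
    by (intro assignment_value_cong) simp
  also have "\<dots> \<le> OPT V s ws"
    unfolding OPT_def using assms
    by (intro Max_ge finite_imageI finite_PiE imageI) (auto simp: machine_env_def)
  finally show ?thesis .
qed

lemma OPT_nonneg:
  assumes "machine_env V s" and "job_sequence ws"
  shows "OPT V s ws \<ge> 0"
proof -
  obtain u where "u \<in> V" using assms by (auto simp: machine_env_def)
  then have "assignment_value V s ws (\<lambda>_. u) \<le> OPT V s ws"
    using assms by (intro assignment_value_le_OPT) auto
  then show ?thesis
    using assignment_value_nonneg[OF assms, of "\<lambda>_. u"] by linarith
qed

text \<open>Under an injective assignment no job displaces another, so every job earns its full
  product; \<open>OPT\<close> is bounded below without being computed.\<close>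

lemma sum_le_OPT:
  assumes "machine_env V s" and "job_sequence ws"
    and f: "f \<in> {..<length ws} \<rightarrow> V" and inj: "inj_on f {..<length ws}"
  shows "(\<Sum>i<length ws. s (f i) * ws ! i) \<le> OPT V s ws"
proof -
  have pos: "s u \<ge> 0" if "u \<in> V" for u
    using assms(1) that by (auto simp: machine_env_def less_imp_le)
  have "(\<Sum>i<length ws. s (f i) * ws ! i) \<le> (\<Sum>i<length ws. s (f i) * max_job ws f (f i))"
    using f pos by (intro sum_mono mult_left_mono max_job_ge) auto
  also have "\<dots> = (\<Sum>u\<in>f ` {..<length ws}. s u * max_job ws f u)"
    by (simp add: sum.reindex[OF inj])
  also have "\<dots> \<le> assignment_value V s ws f"
    unfolding assignment_value_def using f assms(1,2) pos
    by (intro sum_mono2 mult_nonneg_nonneg max_job_nonneg)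
       (auto simp: machine_env_def job_sequence_def)
  also have "\<dots> \<le> OPT V s ws" by (rule assignment_value_le_OPT) fact+
  finally show ?thesis .
qed

lemma competitive_ratio_le:
  assumes "machine_env V s" and "job_sequence ws" and "OPT V s ws > 0"
    and "algorithm_value A V s ws \<le> c * OPT V s ws"
  shows "competitive_ratio A \<le> c"
proof -
  have "competitive_ratio A \<le> algorithm_value A V s ws / OPT V s ws"
    unfolding competitive_ratio_def
  proof (rule cInf_lower)
    show "bdd_below {algorithm_value A V s ws / OPT V s ws | V s ws.
        machine_env V s \<and> job_sequence ws}"
      by (rule bdd_belowI[of _ 0])
        (auto simp: algorithm_value_def intro!: divide_nonneg_nonneg assignment_value_nonneg OPT_nonneg)
  qed (use assms in blast)
  also have "\<dots> \<le> c" using assms by (simp add: divide_le_eq)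
  finally show ?thesis .
qed

section \<open>The job sizes\<close>

text \<open>The second equation is the balance condition at \<open>n = 0\<close> solved for the next
  size. The third is the difference of two consecutive balance conditions, in which the prefix sum
  cancels.\<close>

fun adv_size :: "real \<Rightarrow> real \<Rightarrow> nat \<Rightarrow> real" where
  "adv_size \<rho> s 0 = 1"
| "adv_size \<rho> s (Suc 0) = (1 - \<rho> * s) / (\<rho> - s)"
| "adv_size \<rho> s (Suc (Suc n)) =
     ((1 + \<rho>) * (1 - s) * adv_size \<rho> s (Suc n) - adv_size \<rho> s n) / (\<rho> - s)"

lemma adv_size_balance:
  assumes "s < \<rho>"
  shows "adv_size \<rho> s n + s * adv_size \<rho> s (Suc n)
    = \<rho> * (adv_size \<rho> s (Suc n) + s * (\<Sum>i\<le>n. adv_size \<rho> s i))"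
proof (induction n)
  case 0
  then show ?case using assms by (simp add: field_simps)
next
  case (Suc n)
  have "(\<rho> - s) * adv_size \<rho> s (Suc (Suc n)) =
      (1 + \<rho>) * (1 - s) * adv_size \<rho> s (Suc n) - adv_size \<rho> s n"
    using assms by simp
  with Suc show ?case by (simp add: algebra_simps del: adv_size.simps)
qed

text \<open>The balance condition gives \<open>w (n+1)\<close> in terms of the prefix sum, and
  \<open>good\<close> bounds that sum. Monotonicity ensures that the last job released is the
  largest.\<close>

lemma adv_size_mono_step:
  assumes "0 < s" "s < \<rho>" "\<rho> < 1" and pos: "adv_size \<rho> s n > 0"
    and good: "adv_size \<rho> s n > \<rho> * (adv_size \<rho> s n + s * (\<Sum>i<n. adv_size \<rho> s i))"
  shows "adv_size \<rho> s n \<le> adv_size \<rho> s (Suc n)"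
proof -
  let ?w = "adv_size \<rho> s"
  have "(\<rho> - s) * ?w (Suc n) = ?w n - \<rho> * s * (\<Sum>i<n. ?w i) - \<rho> * s * ?w n"
    using adv_size_balance[OF assms(2), of n]
    by (simp add: algebra_simps lessThan_Suc_atMost[symmetric] del: adv_size.simps)
  also have "\<dots> \<ge> \<rho> * ?w n - \<rho> * s * ?w n"
    using good by (simp add: algebra_simps)
  finally have "(\<rho> - s) * ?w (Suc n) \<ge> \<rho> * ?w n - \<rho> * s * ?w n" .
  moreover have "\<rho> * s * ?w n \<le> s * ?w n"
    using assms pos by simp
  ultimately have "(\<rho> - s) * ?w n \<le> (\<rho> - s) * ?w (Suc n)"
    by (simp add: algebra_simps)
  then show ?thesis using assms(2) by simp
qed

lemma adv_size_terminates:
  assumes "0 < s" "s < \<rho>" "\<rho> < 1"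
    and disc: "((1 + \<rho>) * (1 - s))\<^sup>2 < 4 * (\<rho> - s)"
  shows "\<exists>n. adv_size \<rho> s n \<le> \<rho> * (adv_size \<rho> s n + s * (\<Sum>i<n. adv_size \<rho> s i))"
proof (rule ccontr)
  let ?w = "adv_size \<rho> s"
  define a where "a = \<rho> - s"
  define b where "b = (1 + \<rho>) * (1 - s)"
  \<comment> \<open>By AM-GM, \<open>a * r + 1 / r\<close> is at least \<open>2 * sqrt a\<close>, so
    \<open>r' = (b - 1 / r) / a\<close> lies below \<open>r\<close> by at least
    \<open>d\<close>.\<close>
  define d where "d = (2 * sqrt a - b) / a"
  assume "\<not> ?thesis"
  then have good: "?w n > \<rho> * (?w n + s * (\<Sum>i<n. ?w i))" for n
    by (simp add: not_le)
  have pos: "?w n > 0" for n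
  proof (induction n)
    case (Suc n)
    with adv_size_mono_step[OF assms(1-3) Suc good] show ?case by linarith
  qed simp
  have a: "a > 0" using assms by (simp add: a_def)
  have "b < sqrt (4 * a)"
    using disc unfolding a_def b_def by (rule real_less_rsqrt)
  then have d: "d > 0"
    using a by (simp add: d_def real_sqrt_mult)
  define r where "r n = ?w (Suc n) / ?w n" for n
  have r_pos: "r n > 0" for n using pos by (simp add: r_def)
  have step: "r (Suc n) \<le> r n - d" for n
  proof -
    have "a * r (Suc n) = b - 1 / r n"
      using pos[of n] pos[of "Suc n"] a
      by (simp add: r_def a_def b_def field_simps)
    moreover have "a * r n + 1 / r n \<ge> 2 * sqrt a"
    proof -
      have "0 \<le> (sqrt a * r n - 1)\<^sup>2" by simp
      also have "\<dots> = a * (r n)\<^sup>2 - 2 * sqrt a * r n + 1"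
        using a by (simp add: power2_eq_square algebra_simps)
      finally show ?thesis using r_pos[of n] by (simp add: field_simps power2_eq_square)
    qed
    moreover have "a * (r n - d) = a * r n - (2 * sqrt a - b)"
    proof -
      have "a * d = 2 * sqrt a - b" using a by (simp add: d_def)
      then show ?thesis by (simp only: right_diff_distrib)
    qed
    ultimately have "a * r (Suc n) \<le> a * (r n - d)" by linarith
    then show ?thesis using a by simp
  qed
  have "r n \<le> r 0 - real n * d" for n
  proof (induction n)
    case (Suc n)
    then show ?case using step[of n] by (simp add: algebra_simps)
  qed simp
  moreover obtain n where "r 0 < real n * d"
    using d reals_Archimedean3 by blast
  ultimately show False using r_pos[of n] by (smt (verit))
qed

section \<open>The lower-bound instance\<close>

text \<open>Machines and sizes depend only on \<open>\<rho>\<close> and \<open>s\<close>; the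
  behaviour of \<open>A\<close> decides only after which job the sequence stops.\<close>

lemma instance_exists:
  assumes A: "online_algorithm A" and "0 < s" "s < \<rho>" "\<rho> < 1"
    and disc: "((1 + \<rho>) * (1 - s))\<^sup>2 < 4 * (\<rho> - s)"
  shows "\<exists>V sp ws. machine_env V sp \<and> job_sequence ws \<and> OPT V sp ws > 0 \<and>
    algorithm_value A V sp ws \<le> \<rho> * OPT V sp ws"
proof -
  define w where "w = adv_size \<rho> s"
  define m where "m = (LEAST n. w n \<le> \<rho> * (w n + s * (\<Sum>i<n. w i)))"
  have m: "w m \<le> \<rho> * (w m + s * (\<Sum>i<m. w i))"
    unfolding m_def
    using adv_size_terminates[OF assms(2-5)] unfolding w_def[symmetric] by (rule LeastI_ex)
  have good: "w n > \<rho> * (w n + s * (\<Sum>i<n. w i))" if "n < m" for n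
    using not_less_Least[OF that[unfolded m_def]] by simp
  have mono_pos: "w n > 0 \<and> (\<forall>i\<le>n. w i \<le> w n)" if "n \<le> m" for n
    using that
  proof (induction n)
    case 0
    then show ?case by (simp add: w_def)
  next
    case (Suc n)
    then have "w n \<le> w (Suc n)"
      using adv_size_mono_step[OF assms(2-4), of n] good[of n] by (simp add: w_def)
    with Suc show ?case by (auto simp: le_Suc_eq)
  qed

  \<comment> \<open>Machine 0 is the fast one. The \<open>m\<close> slow ones suffice for all jobs
    but the last, since at most \<open>m + 1\<close> jobs arrive.\<close>
  define V where "V = {..m}"
  define sp where "sp = (\<lambda>u::nat. if u = 0 then 1 else s)"
  define jobs where "jobs n = map w [0..<Suc n]" for n
  define g where "g i = A V sp (jobs i)" for i
  have env: "machine_env V sp"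
    using assms by (auto simp: machine_env_def V_def sp_def)
  have len: "length (jobs n) = Suc n" for n by (simp add: jobs_def)
  have nth: "jobs n ! i = w i" if "i \<le> n" for n i
    using that by (simp add: jobs_def del: upt_Suc)
  have job_seq: "job_sequence (jobs n)" if "n \<le> m" for n
    using mono_pos that by (auto simp: job_sequence_def jobs_def)
  have opt: "w n + s * (\<Sum>i<n. w i) \<le> OPT V sp (jobs n)" if n: "n \<le> m" for n
  proof -
    let ?f = "\<lambda>i. if i = n then 0 else Suc i"
    have "(\<Sum>i<length (jobs n). sp (?f i) * jobs n ! i) \<le> OPT V sp (jobs n)"
      using n by (intro sum_le_OPT env job_seq) (auto simp: V_def len inj_on_def)
    moreover have "(\<Sum>i<length (jobs n). sp (?f i) * jobs n ! i) = w n + s * (\<Sum>i<n. w i)"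
      by (simp add: len nth sp_def sum_distrib_left)
    ultimately show ?thesis by simp
  qed
  have opt_pos: "OPT V sp (jobs n) > 0" if n: "n \<le> m" for n
  proof -
    have "s * (\<Sum>i<n. w i) \<ge> 0"
      using assms(2) mono_pos n by (intro mult_nonneg_nonneg sum_nonneg) (auto simp: less_imp_le)
    then show ?thesis using opt[OF n] mono_pos[OF n] by linarith
  qed
  \<comment> \<open>The sequences \<open>jobs n\<close> are prefixes of one another, so a single
    decision function \<open>g\<close> describes \<open>A\<close> on all of them.\<close>
  have g_val: "algorithm_value A V sp (jobs n) = assignment_value V sp (jobs n) g" for n
  proof -
    have "take (Suc i) (jobs n) = jobs i" if "i \<le> n" for i
      using that by (simp add: jobs_def take_map del: upt_Suc)
    then show ?thesis unfolding algorithm_value_def g_def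
      by (intro assignment_value_cong) (simp add: len)
  qed

  have "\<exists>n\<le>m. assignment_value V sp (jobs n) g \<le> \<rho> * (w n + s * (\<Sum>i<n. w i))"
  proof (cases "\<exists>i\<le>m. g i \<noteq> 0")
    \<comment> \<open>All jobs up to \<open>m\<close> go to the fast machine: stop at
      \<open>m\<close>, where keeping only \<open>w m\<close> is too little.\<close>
    case False
    have "assignment_value V sp (jobs m) g \<le> (\<Sum>u\<in>V. if u = 0 then w m else 0)"
      unfolding assignment_value_def
    proof (rule sum_mono)
      fix u
      show "sp u * max_job (jobs m) g u \<le> (if u = 0 then w m else 0)"
      proof (cases "u = 0")
        case True
        have "max_job (jobs m) g 0 \<le> w m"
          using mono_pos[of m] by (intro max_job_le) (auto simp: len nth)
        then show ?thesis using True by (simp add: sp_def)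
      next
        case u: False
        have "max_job (jobs m) g u \<le> 0"
          using False u by (intro max_job_le) (auto simp: len)
        then show ?thesis using u assms(2) by (simp add: sp_def mult_le_0_iff)
      qed
    qed
    also have "\<dots> = w m" by (simp add: V_def)
    finally show ?thesis using m by auto
  next
    case True
    \<comment> \<open>Stop at the first job placed on a slow machine: the fast one then holds
      exactly the earlier jobs, and \<open>g n\<close> holds job \<open>n\<close> alone.\<close>
    define n where "n = (LEAST i. i \<le> m \<and> g i \<noteq> 0)"
    have n: "n \<le> m" "g n \<noteq> 0"
      using LeastI_ex[OF True] by (auto simp: n_def)
    have g0: "g i = 0" if "i < n" for i
      using not_less_Least[OF that[unfolded n_def]] that n by auto
    have gV: "g n \<in> V"
      using A env job_seq[OF n(1)] by (auto simp: online_algorithm_def g_def)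
    define c where "c = (if n = 0 then 0 else w (n - 1))"
    have c: "c \<ge> 0" "\<And>i. i < n \<Longrightarrow> w i \<le> c"
      using mono_pos[of "n - 1"] n(1) by (auto simp: c_def less_imp_le)
    have "assignment_value V sp (jobs n) g
        \<le> (\<Sum>u\<in>V. (if u = 0 then c else 0) + (if u = g n then s * w n else 0))"
      unfolding assignment_value_def
    proof (rule sum_mono)
      fix u
      show "sp u * max_job (jobs n) g u
          \<le> (if u = 0 then c else 0) + (if u = g n then s * w n else 0)"
      proof (cases "u = 0")
        case True
        have "max_job (jobs n) g 0 \<le> c"
          using c n by (intro max_job_le) (auto simp: len nth less_Suc_eq)
        then show ?thesis using True n by (simp add: sp_def)
      next
        case u: False
        have "max_job (jobs n) g u \<le> (if u = g n then w n else 0)"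
          using g0 u mono_pos[OF n(1)] by (intro max_job_le) (auto simp: len nth less_Suc_eq)
        then have "s * max_job (jobs n) g u \<le> s * (if u = g n then w n else 0)"
          using assms(2) by (intro mult_left_mono) auto
        then show ?thesis using u by (auto simp: sp_def)
      qed
    qed
    also have "\<dots> = c + s * w n"
      using gV by (simp add: sum.distrib V_def)
    also have "\<dots> \<le> \<rho> * (w n + s * (\<Sum>i<n. w i))"
    proof (cases n)
      \<comment> \<open>The very first job is placed on a slow machine; no balance condition covers
        this, but the ratio is \<open>s < \<rho>\<close>.\<close>
      case 0
      then show ?thesis using assms(3) by (simp add: c_def w_def)
    next
      case (Suc k)
      then show ?thesis
        using adv_size_balance[OF assms(3), of k] by (simp add: c_def w_def lessThan_Suc_atMost)
    qed
    finally show ?thesis using n by blast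
  qed
  then obtain n where n: "n \<le> m"
    and "assignment_value V sp (jobs n) g \<le> \<rho> * (w n + s * (\<Sum>i<n. w i))" by blast
  moreover have "\<rho> * (w n + s * (\<Sum>i<n. w i)) \<le> \<rho> * OPT V sp (jobs n)"
    using opt[OF n] assms by (intro mult_left_mono) auto
  ultimately have "algorithm_value A V sp (jobs n) \<le> \<rho> * OPT V sp (jobs n)"
    by (simp add: g_val)
  then show ?thesis using env job_seq[OF n] opt_pos[OF n] by blast
qed

lemma slow_speed_exists:
  fixes \<rho> :: real
  assumes "(sqrt 5 - 1) / 2 < \<rho>" "\<rho> < 1"
  obtains s where "0 < s" "s < \<rho>" "((1 + \<rho>) * (1 - s))\<^sup>2 < 4 * (\<rho> - s)"
proof
  define c where "c = (1 + \<rho>)\<^sup>2"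
  have "sqrt 5 > 2" by (rule real_less_rsqrt) simp
  then have half: "\<rho> > 1 / 2" using assms by (simp add: field_simps)
  have "(sqrt 5)\<^sup>2 < (2 * \<rho> + 1)\<^sup>2"
    using assms by (intro power_strict_mono) auto
  then have golden: "\<rho>\<^sup>2 + \<rho> > 1" by (simp add: power2_eq_square algebra_simps)
  have "(3 / 2)\<^sup>2 < c" "c < 2\<^sup>2"
    unfolding c_def using half assms by (intro power_strict_mono; simp)+
  then have c: "2 < c" "c < 4" by (simp_all add: power2_eq_square)
  \<comment> \<open>With \<open>t = 1 - s\<close> the goal reads
    \<open>c * t\<^sup>2 - 4 * t < 4 * (\<rho> - 1)\<close>; the left side is minimal at
    \<open>t = 2 / c\<close>, with value \<open>- 4 / c\<close>.\<close>
  define s where "s = 1 - 2 / c"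
  show "0 < 1 - 2 / (1 + \<rho>)\<^sup>2" using c by (simp flip: c_def)
  have "s < 1 / 2" using c by (simp add: s_def field_simps)
  then have "s < \<rho>" using half by linarith
  then show "1 - 2 / (1 + \<rho>)\<^sup>2 < \<rho>" by (simp add: s_def c_def)
  have "(1 - \<rho>) * c = 1 - \<rho> * (\<rho>\<^sup>2 + \<rho> - 1)"
    by (simp add: c_def power2_eq_square algebra_simps)
  then have "(1 - \<rho>) * c < 1" using golden half by simp
  then have "1 - \<rho> < 1 / c" using c by (simp add: field_simps)
  moreover have "((1 + \<rho>) * (1 - s))\<^sup>2 = 4 / c"
  proof -
    have "((1 + \<rho>) * (1 - s))\<^sup>2 = c * (2 / c)\<^sup>2"
      unfolding power_mult_distrib c_def[symmetric] by (simp add: s_def)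
    then show ?thesis by (simp add: power2_eq_square)
  qed
  ultimately have "((1 + \<rho>) * (1 - s))\<^sup>2 < 4 * (\<rho> - s)" by (simp add: s_def)
  then show "((1 + \<rho>) * (1 - (1 - 2 / (1 + \<rho>)\<^sup>2)))\<^sup>2 < 4 * (\<rho> - (1 - 2 / (1 + \<rho>)\<^sup>2))"
    by (simp add: s_def c_def)
qed

theorem theorem7:
  fixes A :: algorithm and \<epsilon> :: real
  assumes "\<epsilon> > 0" and "online_algorithm A"
  shows "competitive_ratio A \<le> (sqrt 5 - 1) / 2 + \<epsilon> \<and>
    (\<exists>V s ws. machine_env V s \<and> job_sequence ws \<and>
       algorithm_value A V s ws \<le> ((sqrt 5 - 1) / 2 + \<epsilon>) * OPT V s ws)"
proof -
  let ?c = "(sqrt 5 - 1) / 2 + \<epsilon>"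
  have "sqrt 5 < 3" by (rule real_less_lsqrt) auto
  \<comment> \<open>The construction needs \<open>\<rho> < 1\<close>, whereas
    \<open>\<epsilon>\<close> may be large; hence the minimum with 1.\<close>
  then have "(sqrt 5 - 1) / 2 < min 1 ?c" using assms(1) by simp
  then obtain \<rho> where \<rho>: "(sqrt 5 - 1) / 2 < \<rho>" "\<rho> < 1" "\<rho> < ?c"
    using dense by (metis min_less_iff_conj)
  obtain s where s: "0 < s" "s < \<rho>" "((1 + \<rho>) * (1 - s))\<^sup>2 < 4 * (\<rho> - s)"
    using slow_speed_exists[OF \<rho>(1,2)] .
  obtain V sp ws where inst: "machine_env V sp" "job_sequence ws" "OPT V sp ws > 0"
    and "algorithm_value A V sp ws \<le> \<rho> * OPT V sp ws"
    using instance_exists[OF assms(2) s(1,2) \<rho>(2) s(3)] by blast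
  moreover have "\<rho> * OPT V sp ws \<le> ?c * OPT V sp ws"
    using \<rho>(3) inst(3) by (intro mult_right_mono) auto
  ultimately have "algorithm_value A V sp ws \<le> ?c * OPT V sp ws" by linarith
  with competitive_ratio_le[OF inst this] inst show ?thesis by blast
qed

end
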